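(* For every integer $n\ge 0$, \[ s_{n+1}^{(3)}=\frac{1}{n+1}\sum_{i=0}^n(-2)^{n-i}\binom{n+1}{i}\left(\sum_{j=0}^i\binom{i}{j}\binom{2i+j}{n}\right), \] where $s_{n+1}^{(3)}$ denotes the $(n+1)$-th small $3$-Schröder number.
   Context: Let $m\ge 2$ and $n\ge 1$ be integers. An $m$-Schröder path of length $mn$ is a lattice path from $(0,0)$ to $(mn,0)$ which never goes below the $x$-axis, with steps $U=(1,1)$, $D^{(m)}=(1,1-m)$ and $H^{(m)}=(2,2-m)$. A small $m$-Schröder path is an $m$-Schröder path with no step of type $H^{(m)}$ ending on the $x$-axis. The $n$-th small $m$-Schröder number $s_n^{(m)}$ is the number of small $m$-Schröder paths of length $mn$. (So for $m=3$ the steps are $(1,1)$, $(1,-2)$, $(2,-1)$, and $s_{n+1}^{(3)}$ counts small $3$-Schröder paths from $(0,0)$ to $(3(n+1),0)$.) For non-negative integers $a,b$, $\binom{a}{b}=0$ if $b>a$. *)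

theory Defs
  imports Complex_Main "HOL-Library.Product_Plus"
begin

text \<open>Lattice paths starting at the origin are represented by their lists of steps.\<close>

datatype step = U | D | H

fun step_vec :: "nat \<Rightarrow> step \<Rightarrow> int \<times> int" where
  "step_vec m U = (1, 1)"
| "step_vec m D = (1, 1 - int m)"
| "step_vec m H = (2, 2 - int m)"

definition endpoint :: "nat \<Rightarrow> step list \<Rightarrow> int \<times> int" where
  "endpoint m p = (\<Sum>s\<leftarrow>p. step_vec m s)"

text \<open>
  The points \<open>endpoint m (take k p)\<close> for \<open>k \<le> length p\<close> are the vertices of the path \<open>p\<close>;
  as steps are straight segments, a path stays weakly above the x-axis iff all its vertices do.
\<close>

definition schroeder_path :: "nat \<Rightarrow> nat \<Rightarrow> step list \<Rightarrow> bool" where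
  "schroeder_path m n p \<longleftrightarrow>
     endpoint m p = (int (m * n), 0) \<and>
     (\<forall>k\<le>length p. snd (endpoint m (take k p)) \<ge> 0)"

definition small_schroeder_path :: "nat \<Rightarrow> nat \<Rightarrow> step list \<Rightarrow> bool" where
  "small_schroeder_path m n p \<longleftrightarrow>
     schroeder_path m n p \<and>
     (\<forall>k<length p. p ! k = H \<longrightarrow> snd (endpoint m (take (Suc k) p)) \<noteq> 0)"

text \<open>Meant for \<open>m \<ge> 2\<close> and \<open>n \<ge> 1\<close>.\<close>

definition small_schroeder_number :: "nat \<Rightarrow> nat \<Rightarrow> nat" where
  "small_schroeder_number m n = card {p. small_schroeder_path m n p}"

text \<open>The cardinality above is that of a finite set, so it is a genuine count.\<close>

lemma length_le_endpoint: "int (length p) \<le> fst (endpoint m p)"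
proof (induction p)
  case Nil
  show ?case by (simp add: endpoint_def)
next
  case (Cons s p)
  then show ?case by (cases s) (simp_all add: endpoint_def)
qed

lemma finite_small_schroeder_paths: "finite {p. small_schroeder_path m n p}"
proof (rule finite_subset)
  have "(UNIV :: step set) = {U, D, H}"
    using step.exhaust by blast
  then have "finite (UNIV :: step set)"
    by (metis finite.emptyI finite_insert)
  then show "finite {p :: step list. set p \<subseteq> UNIV \<and> length p \<le> m * n}"
    by (rule finite_lists_length_le)
  have "length p \<le> m * n" if "small_schroeder_path m n p" for p
  proof -
    have "fst (endpoint m p) = int (m * n)"
      using that by (simp add: small_schroeder_path_def schroeder_path_def)
    with length_le_endpoint[of p m] show ?thesis by linarith
  qed
  then show "{p. small_schroeder_path m n p} \<subseteq> {p. set p \<subseteq> UNIV \<and> length p \<le> m * n}"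
    by blast
qed

end

theory Submission
  imports Defs "HOL-Computational_Algebra.Formal_Power_Series"
begin

text \<open>
  Give every step \<open>D\<close> and every step \<open>H\<close> the weight \<open>x\<close>, so that the small \<open>m\<close>-Schroeder paths of
  length \<open>m n\<close> are counted by \<open>x ^ n\<close>. Let \<open>y\<close> be the power series with \<open>y = x (1 + y)^(m-1) (2 + y)\<close>.
  Removing the last step of a path gives a recursion for the numbers of admissible paths that end at
  height \<open>h\<close>, and this recursion is solved by the coefficients of \<open>(1 + y)^h (1 + y/2)\<close>
  (lemma \<open>card_small_prefixes\<close>). At height \<open>0\<close> this says that the number sought is
  half the coefficient of \<open>x ^ (n+1)\<close> in \<open>y\<close>. By Lagrange inversion (lemma \<open>lagrange_inversion\<close>),
  with \<open>Q = (1 + t)^(m-1) (2 + t)\<close>, it equals \<open>[t^n] Q^(n+1) / (2 (n+1))\<close>.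

  For \<open>m = 3\<close> the double sum is another expression of this coefficient: \<open>Q - 2\<close> is divisible by \<open>t\<close>,
  so \<open>(Q - 2)^(n+1)\<close> has no term of degree \<open>n\<close>, and the binomial expansion of this power expresses
  \<open>[t^n] Q^(n+1)\<close> by the coefficients \<open>[t^n] Q^i\<close> with \<open>i \<le> n\<close>. The inner sum is such a coefficient, as
  \<open>Q^i = (1 + t)^(2i) (1 + (1 + t))^i\<close>.
\<close>

unbundle fps_syntax

section \<open>Lagrange inversion\<close>

text \<open>
  Only the coefficients of \<open>F \<circ> y\<close> in positive degree are concerned, so \<open>F\<close> may be replaced by
  \<open>t G\<close>, and \<open>(t G) \<circ> y = x ((Q G) \<circ> y)\<close> lowers the degree by one.
\<close>

lemma lagrange_inversion:
  fixes y Q F :: "'a :: {idom, ring_char_0} fps"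
  assumes y: "y = fps_X * (Q oo y)"
  shows "of_nat (Suc m) * (F oo y) $ Suc m = (fps_deriv F * Q ^ Suc m) $ m"
proof (induction m arbitrary: F)
  have y0: "y $ 0 = 0"
    by (subst y) simp
  have shift: "(F oo y) $ Suc m = ((Q * fps_shift 1 F) oo y) $ m" for F m
  proof -
    have "F = fps_const (F $ 0) + fps_X * fps_shift 1 F"
      by (rule fps_ext) simp
    then have "F oo y = fps_const (F $ 0) + y * (fps_shift 1 F oo y)"
      using y0 by (metis fps_compose_add_distrib fps_compose_mult_distrib fps_const_compose
          fps_X_fps_compose_startby0)
    also have "y * (fps_shift 1 F oo y) = fps_X * ((Q oo y) * (fps_shift 1 F oo y))"
      by (subst y) (simp only: mult.assoc)
    also have "(Q oo y) * (fps_shift 1 F oo y) = (Q * fps_shift 1 F) oo y"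
      by (rule fps_compose_mult_distrib[OF y0, symmetric])
    finally show ?thesis by simp
  qed
  {
    case (0 F)
    show ?case by (simp add: shift)
  next
    case (Suc l F)
    define G where "G = fps_shift 1 F"
    define P where "P = Q ^ Suc l"
    define c where "c = (F oo y) $ Suc (Suc l)"
    define g where "g = (G * (Q * P)) $ Suc l"
    define A where "A = (G * fps_deriv Q * P) $ l"
    define B where "B = (fps_deriv G * (Q * P)) $ l"
    have F: "F = fps_const (F $ 0) + fps_X * G"
      unfolding G_def by (rule fps_ext) simp
    have c: "of_nat (Suc l) * c = A + B"
    proof -
      have "of_nat (Suc l) * c = (fps_deriv (Q * G) * P) $ l"
        unfolding c_def shift[of F] G_def[symmetric] P_def by (rule Suc.IH)
      also have "fps_deriv (Q * G) * P = G * fps_deriv Q * P + fps_deriv G * (Q * P)"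
        by (simp add: algebra_simps)
      finally show ?thesis by (simp add: A_def B_def)
    qed
    \<comment> \<open>The coefficients of \<open>G Q' P\<close> and of \<open>G P Q\<close> are related by the derivative of \<open>G Q^(l+2)\<close>.\<close>
    have g: "of_nat (Suc l) * g = B + of_nat (Suc (Suc l)) * A"
    proof -
      have "of_nat (Suc l) * g = fps_deriv (G * (Q * P)) $ l"
        by (simp only: g_def fps_deriv_nth Suc_eq_plus1)
      also have "Q * P = Q ^ Suc (Suc l)" by (simp add: P_def)
      also have "fps_deriv (G * Q ^ Suc (Suc l)) =
          fps_deriv G * (Q * P) + fps_const (of_nat (Suc (Suc l))) * (G * fps_deriv Q * P)"
        by (subst fps_deriv_mult, subst fps_deriv_power) (simp add: P_def algebra_simps)
      finally show ?thesis
        unfolding A_def B_def fps_add_nth fps_mult_left_const_nth .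
    qed
    have goal: "(fps_deriv F * Q ^ Suc (Suc l)) $ Suc l = g + B"
    proof -
      have "fps_deriv F = G + fps_X * fps_deriv G"
        by (subst F) simp
      then have "fps_deriv F * Q ^ Suc (Suc l) = G * (Q * P) + fps_X * (fps_deriv G * (Q * P))"
        by (simp add: P_def algebra_simps)
      then show ?thesis by (simp add: g_def B_def)
    qed
    have "of_nat (Suc l) * (of_nat (Suc (Suc l)) * c) = of_nat (Suc l) * (g + B)"
    proof -
      have "of_nat (Suc l) * (of_nat (Suc (Suc l)) * c) = of_nat (Suc (Suc l)) * (A + B)"
        unfolding c[symmetric] by (rule mult.left_commute)
      also have "\<dots> = of_nat (Suc l) * (g + B)"
        unfolding distrib_left g by (simp add: algebra_simps)
      finally show ?thesis .
    qed
    then have "of_nat (Suc (Suc l)) * c = g + B"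
      by (subst (asm) mult_left_cancel[OF of_nat_neq_0])
    then show ?case unfolding goal c_def .
  }
qed

lemma fps_X_mult_compose_fixpoint_exists:
  fixes Q :: "'a :: field fps"
  assumes Q0: "Q $ 0 \<noteq> 0"
  shows "\<exists>y. y = fps_X * (Q oo y)"
proof
  \<comment> \<open>The solution is the compositional inverse of \<open>t / Q\<close>.\<close>
  define a where "a = fps_X * inverse Q"
  have a0: "a $ 0 = 0" and a1: "a $ 1 \<noteq> 0"
    using Q0 by (simp_all add: a_def)
  define y where "y = fps_inv a"
  have y0: "y $ 0 = 0" by (simp add: y_def fps_inv_def)
  have Qy0: "(Q oo y) $ 0 \<noteq> 0" using Q0 by simp
  have "fps_X = a oo y"
    unfolding y_def by (rule fps_inv_right[OF a0 a1, symmetric])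
  also have "\<dots> = y * inverse (Q oo y)"
    using y0 Q0 by (simp add: a_def fps_compose_mult_distrib fps_inverse_compose)
  finally have X: "fps_X = y * inverse (Q oo y)" .
  have "fps_X * (Q oo y) = y * (inverse (Q oo y) * (Q oo y))"
    by (subst X) (rule mult.assoc)
  then show "y = fps_X * (Q oo y)"
    using inverse_mult_eq_1[OF Qy0] by simp
qed

section \<open>Counting small paths by their final height\<close>

text \<open>The height of the last vertex of a path.\<close>

definition height :: "nat \<Rightarrow> step list \<Rightarrow> int" where
  "height m p = snd (endpoint m p)"

lemma endpoint_snoc: "endpoint m (p @ [s]) = endpoint m p + step_vec m s"
  by (simp add: endpoint_def)

lemma height_Nil [simp]: "height m [] = 0"
  by (simp add: height_def endpoint_def)

lemma height_snoc [simp]: "height m (p @ [s]) = height m p + snd (step_vec m s)"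
  by (simp add: height_def endpoint_snoc)

text \<open>
  Paths with any final height that never go below the axis and have no step \<open>H\<close> ending on it.
\<close>

definition admissible :: "nat \<Rightarrow> step list \<Rightarrow> bool" where
  "admissible m p \<longleftrightarrow>
     (\<forall>k\<le>length p. height m (take k p) \<ge> 0) \<and>
     (\<forall>k<length p. p ! k = H \<longrightarrow> height m (take (Suc k) p) \<noteq> 0)"

lemma admissible_Nil [simp]: "admissible m []"
  by (simp add: admissible_def)

lemma admissible_snoc:
  "admissible m (p @ [s]) \<longleftrightarrow>
     admissible m p \<and> height m (p @ [s]) \<ge> 0 \<and> (s = H \<longrightarrow> height m (p @ [s]) \<noteq> 0)"
  by (auto simp: admissible_def le_Suc_eq less_Suc_eq nth_append simp del: height_snoc)

lemma admissible_height_nonneg: "admissible m p \<Longrightarrow> height m p \<ge> 0"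
  by (auto simp: admissible_def)

text \<open>
  The admissible paths that end at height \<open>h\<close> and have exactly \<open>n\<close> steps other than \<open>U\<close>.
\<close>

definition small_prefixes :: "nat \<Rightarrow> nat \<Rightarrow> nat \<Rightarrow> step list set" where
  "small_prefixes m n h =
     {p. admissible m p \<and> height m p = int h \<and> length (filter (\<lambda>s. s \<noteq> U) p) = n}"

lemma endpoint_conv_height:
  "fst (endpoint m p) = height m p + int m * int (length (filter (\<lambda>s. s \<noteq> U) p))"
proof (induction p)
  case Nil
  show ?case by (simp add: endpoint_def)
next
  case (Cons s p)
  then show ?case by (cases s) (simp_all add: endpoint_def height_def algebra_simps)
qed

lemma small_schroeder_path_iff:
  assumes "m > 0"
  shows "small_schroeder_path m n p \<longleftrightarrow> p \<in> small_prefixes m n 0"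
proof -
  have "endpoint m p = (int (m * n), 0) \<longleftrightarrow>
      height m p = 0 \<and> length (filter (\<lambda>s. s \<noteq> U) p) = n"
    using assms by (auto simp: prod_eq_iff endpoint_conv_height simp flip: height_def)
  then show ?thesis
    by (auto simp: small_schroeder_path_def schroeder_path_def small_prefixes_def admissible_def
        simp flip: height_def)
qed

lemma Nil_in_small_prefixes: "[] \<in> small_prefixes m n h \<longleftrightarrow> n = 0 \<and> h = 0"
  by (auto simp: small_prefixes_def)

text \<open>
  The condition \<open>h \<noteq> 0\<close> has different reasons in the two cases where it occurs: a step \<open>U\<close> that ends
  on the axis would start below it, while a step \<open>H\<close> that ends there is excluded for small paths.
\<close>

lemma snoc_in_small_prefixes:
  assumes "m \<ge> 2"
  shows "p @ [U] \<in> small_prefixes m n h \<longleftrightarrow> h \<noteq> 0 \<and> p \<in> small_prefixes m n (h - 1)"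
    and "p @ [D] \<in> small_prefixes m n h \<longleftrightarrow> n \<noteq> 0 \<and> p \<in> small_prefixes m (n - 1) (h + m - 1)"
    and "p @ [H] \<in> small_prefixes m n h \<longleftrightarrow>
           n \<noteq> 0 \<and> h \<noteq> 0 \<and> p \<in> small_prefixes m (n - 1) (h + m - 2)"
  using assms admissible_height_nonneg[of m p]
  by (auto simp: small_prefixes_def admissible_snoc)

lemma small_prefixes_rec:
  assumes "m \<ge> 2"
  shows "small_prefixes m 0 0 = {[]}"
    and "small_prefixes m 0 (Suc h) = (\<lambda>p. p @ [U]) ` small_prefixes m 0 h"
    and "small_prefixes m (Suc n) 0 = (\<lambda>p. p @ [D]) ` small_prefixes m n (m - 1)"
    and "small_prefixes m (Suc n) (Suc h) =
      (\<lambda>p. p @ [U]) ` small_prefixes m (Suc n) h \<union>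
      ((\<lambda>p. p @ [D]) ` small_prefixes m n (h + m) \<union>
       (\<lambda>p. p @ [H]) ` small_prefixes m n (h + m - 1))"
proof -
  note mem = Nil_in_small_prefixes snoc_in_small_prefixes[OF assms]
  have eqI: "A = B" if "[] \<in> A \<longleftrightarrow> [] \<in> B" "\<And>p. p @ [U] \<in> A \<longleftrightarrow> p @ [U] \<in> B"
    "\<And>p. p @ [D] \<in> A \<longleftrightarrow> p @ [D] \<in> B" "\<And>p. p @ [H] \<in> A \<longleftrightarrow> p @ [H] \<in> B" for A B
  proof (rule set_eqI)
    show "p \<in> A \<longleftrightarrow> p \<in> B" for p
    proof (cases p rule: rev_exhaust)
      case Nil
      then show ?thesis using that(1) by simp
    next
      case (snoc q s)
      then show ?thesis using that(2-) by (cases s) simp_all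
    qed
  qed
  show "small_prefixes m 0 0 = {[]}"
    by (rule eqI) (auto simp: mem)
  show "small_prefixes m 0 (Suc h) = (\<lambda>p. p @ [U]) ` small_prefixes m 0 h"
    by (rule eqI) (auto simp: mem)
  show "small_prefixes m (Suc n) 0 = (\<lambda>p. p @ [D]) ` small_prefixes m n (m - 1)"
    by (rule eqI) (auto simp: mem)
  show "small_prefixes m (Suc n) (Suc h) =
      (\<lambda>p. p @ [U]) ` small_prefixes m (Suc n) h \<union>
      ((\<lambda>p. p @ [D]) ` small_prefixes m n (h + m) \<union>
       (\<lambda>p. p @ [H]) ` small_prefixes m n (h + m - 1))"
    using assms by (intro eqI) (auto simp: mem)
qed

lemma card_image_snoc: "card ((\<lambda>p. p @ [s]) ` A) = card A"
  by (rule card_image) (auto simp: inj_on_def)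

lemma finite_small_prefixes:
  assumes "m \<ge> 2"
  shows "finite (small_prefixes m n h)"
proof (induction n arbitrary: h)
  case 0
  show ?case by (induction h) (simp_all add: small_prefixes_rec[OF assms])
next
  case (Suc n)
  show ?case by (induction h) (simp_all add: small_prefixes_rec[OF assms] Suc)
qed

text \<open>
  The series \<open>(1 + y)^h (1 + y/2)\<close> satisfies the recursion for the last step because
  \<open>y = x (1 + y)^(m-1) + x (1 + y)^m\<close>, where the two terms belong to \<open>H\<close> and \<open>D\<close>. At height \<open>0\<close> there
  is no step \<open>H\<close>, and \<open>y/2 = x (1 + y)^(m-1) (1 + y/2)\<close>.
\<close>

lemma card_small_prefixes:
  fixes y :: "real fps"
  assumes m: "m \<ge> 2" and y: "y = fps_X * ((1 + y) ^ (m - 1) * (2 + y))"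
  shows "real (card (small_prefixes m n h)) = ((1 + y) ^ h * (1 + fps_const (1/2) * y)) $ n"
proof -
  define T where "T h = (1 + y) ^ h * (1 + fps_const (1/2) * y)" for h
  have y0: "y $ 0 = 0"
    by (subst y) simp
  have half: "fps_const (1/2) * (2 + y) = 1 + fps_const (1/2) * y"
    by (simp add: fps_eq_iff numeral_fps_const distrib_left)
  have T_0: "T 0 = 1 + fps_X * T (m - 1)"
  proof -
    have "fps_const (1/2) * y = fps_const (1/2) * (fps_X * ((1 + y) ^ (m - 1) * (2 + y)))"
      using y by (rule arg_cong)
    also have "\<dots> = fps_X * ((1 + y) ^ (m - 1) * (fps_const (1/2) * (2 + y)))"
      by (simp only: ac_simps)
    finally show ?thesis
      by (simp only: half T_def power_0 mult_1_left)
  qed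
  have T_Suc: "T (Suc h) = T h + fps_X * (T (h + m) + T (h + m - 1))" for h
  proof -
    obtain k where k: "m = Suc k" using m by (cases m) auto
    have "T (Suc h) = T h + T h * y"
      by (simp add: T_def algebra_simps)
    also have "T h * y = T h * (fps_X * ((1 + y) ^ (m - 1) * (2 + y)))"
      using y by (rule arg_cong)
    also have "2 + y = (1 + y) + 1" by simp
    also have "T h * (fps_X * ((1 + y) ^ (m - 1) * ((1 + y) + 1))) =
        fps_X * (T (h + m) + T (h + m - 1))"
      by (simp add: T_def k power_add algebra_simps)
    finally show ?thesis .
  qed
  have T0: "T h $ 0 = 1" for h
    by (induction h) (simp_all add: T_0 T_Suc)
  have "real (card (small_prefixes m n h)) = T h $ n"
  proof (induction n arbitrary: h)
    case 0
    show ?case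
      by (induction h) (simp_all add: small_prefixes_rec[OF m] card_image_snoc T0)
  next
    case (Suc n)
    note IH = Suc
    show ?case
    proof (induction h)
      case 0
      show ?case
        by (simp add: small_prefixes_rec[OF m] card_image_snoc IH T_0)
    next
      case (Suc h)
      have "card (small_prefixes m (Suc n) (Suc h)) = card (small_prefixes m (Suc n) h) +
          (card (small_prefixes m n (h + m)) + card (small_prefixes m n (h + m - 1)))"
        unfolding small_prefixes_rec(4)[OF m]
        by (subst card_Un_disjoint,
            auto simp: finite_small_prefixes[OF m] card_image_snoc)+
      then show ?case
        by (simp add: Suc IH T_Suc)
    qed
  qed
  then show ?thesis by (simp add: T_def)
qed

theorem small_schroeder_number_conv_coeff:
  assumes m: "m \<ge> 2"
  shows "2 * real (n + 1) * real (small_schroeder_number m (n + 1)) =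
    (((1 + fps_X) ^ (m - 1) * (2 + fps_X)) ^ (n + 1)) $ n"
proof -
  define Q :: "real fps" where "Q = (1 + fps_X) ^ (m - 1) * (2 + fps_X)"
  have "Q $ 0 \<noteq> 0"
    by (simp add: Q_def fps_nth_power_0)
  then obtain y where y: "y = fps_X * (Q oo y)"
    using fps_X_mult_compose_fixpoint_exists by blast
  have y0: "y $ 0 = 0"
    by (subst y) simp
  have "Q oo y = (1 + y) ^ (m - 1) * (2 + y)"
    by (simp add: Q_def y0 fps_compose_mult_distrib fps_compose_add_distrib
        flip: fps_compose_power)
  with y have y': "y = fps_X * ((1 + y) ^ (m - 1) * (2 + y))" by simp
  have "small_schroeder_number m (n + 1) = card (small_prefixes m (n + 1) 0)"
    using m by (simp add: small_schroeder_number_def small_schroeder_path_iff)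
  then have "2 * real (small_schroeder_number m (n + 1)) = y $ (n + 1)"
    using card_small_prefixes[OF m y', of "n + 1" 0] by simp
  moreover have "real (n + 1) * y $ (n + 1) = (Q ^ (n + 1)) $ n"
    using lagrange_inversion[OF y, of n fps_X] y0 by simp
  ultimately show ?thesis
    unfolding Q_def by (simp add: algebra_simps)
qed

section \<open>The double sum\<close>

lemma one_plus_fps_X_power_nth:
  "((1 + fps_X :: 'a :: field_char_0 fps) ^ k) $ n = of_nat (k choose n)"
  by (metis fps_binomial_of_nat fps_binomial_nth binomial_gbinomial)

lemma power_nth_conv_double_sum:
  "(((1 + fps_X :: real fps) ^ 2 * (2 + fps_X)) ^ i) $ n =
     (\<Sum>j=0..i. real (i choose j) * real ((2 * i + j) choose n))"
proof -
  have "(2 + fps_X :: real fps) = (1 + fps_X) + 1" by simp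
  then have "((1 + fps_X :: real fps) ^ 2 * (2 + fps_X)) ^ i =
      (1 + fps_X) ^ (2 * i) * ((1 + fps_X) + 1) ^ i"
    by (simp only: power_mult_distrib power_mult)
  also have "\<dots> = (\<Sum>j\<le>i. fps_const (real (i choose j)) * (1 + fps_X) ^ (2 * i + j))"
    by (subst binomial_ring)
      (simp add: sum_distrib_left power_add fps_of_nat algebra_simps)
  finally show ?thesis
    by (simp add: fps_sum_nth one_plus_fps_X_power_nth atMost_atLeast0)
qed

text \<open>
  The left-hand side is, up to the sign, the binomial expansion of
  \<open>[t^n] (Q - 2)^(n+1) = 0\<close> without its term \<open>[t^n] Q^(n+1)\<close>.
\<close>

lemma alternating_sum_power_nth:
  fixes Q :: "'a :: comm_ring_1 fps"
  assumes "Q $ 0 = 2"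
  shows "2 * (\<Sum>i=0..n. (- 2) ^ (n - i) * of_nat ((n + 1) choose i) * (Q ^ i) $ n) =
    (Q ^ (n + 1)) $ n"
proof -
  define R where "R = fps_shift 1 Q"
  have minus_two: "(- 2 :: 'a fps) = fps_const (- 2)"
    by (simp add: numeral_fps_const)
  have "Q = 2 + fps_X * R"
    using assms by (intro fps_ext) (simp add: R_def numeral_fps_const)
  then have "Q + (- 2) = fps_X * R" by simp
  then have "(Q + (- 2)) ^ (n + 1) = fps_X ^ (n + 1) * R ^ (n + 1)"
    by (simp only: power_mult_distrib)
  then have "0 = ((Q + (- 2)) ^ (n + 1)) $ n"
    by (simp only: fps_X_power_mult_nth) simp
  also have "(Q + (- 2)) ^ (n + 1) =
      (\<Sum>i\<le>n+1. fps_const (of_nat ((n + 1) choose i) * (- 2) ^ (n + 1 - i)) * Q ^ i)"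
    unfolding binomial_ring minus_two
    by (rule sum.cong) (simp_all add: ac_simps flip: fps_of_nat)
  also have "\<dots> $ n = (\<Sum>i\<le>n+1. of_nat ((n + 1) choose i) * (- 2) ^ (n + 1 - i) * (Q ^ i) $ n)"
    by (simp add: fps_sum_nth)
  also have "\<dots> = (\<Sum>i\<le>n. of_nat ((n + 1) choose i) * (- 2) ^ (n + 1 - i) * (Q ^ i) $ n)
      + (Q ^ (n + 1)) $ n"
    by simp
  also have "(\<Sum>i\<le>n. of_nat ((n + 1) choose i) * (- 2) ^ (n + 1 - i) * (Q ^ i) $ n) =
      - (2 * (\<Sum>i=0..n. (- 2) ^ (n - i) * of_nat ((n + 1) choose i) * (Q ^ i) $ n))"
    unfolding atMost_atLeast0 sum_distrib_left sum_negf[symmetric]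
    by (rule sum.cong) (simp_all add: Suc_diff_le algebra_simps)
  finally show ?thesis by simp
qed

theorem theorem3p8:
  fixes n :: nat
  shows "real (small_schroeder_number 3 (n + 1)) =
    1 / real (n + 1) *
      (\<Sum>i=0..n. (- 2) ^ (n - i) * real ((n + 1) choose i) *
        (\<Sum>j=0..i. real (i choose j) * real ((2 * i + j) choose n)))"
proof -
  define Q :: "real fps" where "Q = (1 + fps_X) ^ 2 * (2 + fps_X)"
  define S where "S = (\<Sum>i=0..n. (- 2) ^ (n - i) * real ((n + 1) choose i) *
      (\<Sum>j=0..i. real (i choose j) * real ((2 * i + j) choose n)))"
  have "Q $ 0 = 2"
    by (simp add: Q_def fps_nth_power_0)
  then have "2 * S = (Q ^ (n + 1)) $ n"
    unfolding S_def Q_def power_nth_conv_double_sum[symmetric]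
    by (rule alternating_sum_power_nth)
  also have "\<dots> = 2 * real (n + 1) * real (small_schroeder_number 3 (n + 1))"
    using small_schroeder_number_conv_coeff[of 3 n] by (simp add: Q_def)
  finally show ?thesis
    unfolding S_def[symmetric] by (simp add: field_simps)
qed

end
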